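(* Let $\Sigma$ be a finite alphabet. A quantitative language $f:\Sigma^*\to\mathbb{R}$ belongs to the class $\mathcal{S}^{rat}_{\mathbb{R}_{\ge0}}(\Sigma^* )$ of stochastic rational languages if and only if there exists a locally sub-stochastic weighted automaton $\mathcal{W}$ such that $\llbracket\mathcal{W}\rrbracket=f$.
   Context: A quantitative language over $\Sigma$ is any function $f:\Sigma^*\to\mathbb{R}$. It is stochastic if $f(w)\ge0$ for all $w\in\Sigma^*$ and $\sum_{w\in\Sigma^*}f(w)=1$. A weighted automaton over $\mathbb{R}_{\ge0}$ is a tuple $\mathcal{W}=(\Sigma,Q,\lambda,M,\mu)$ with $Q$ a finite set of states, $\lambda\in\mathbb{R}_{\ge0}^Q$ the initial weight vector, $M_\sigma\in\mathbb{R}_{\ge0}^{Q\times Q}$ a transition matrix for each $\sigma\in\Sigma$, and $\mu\in\mathbb{R}_{\ge0}^Q$ the final weight vector. Its semantics is $\llbracket\mathcal{W}\rrbracket(w_1\cdots w_n)=\lambda^\top M_{w_1}\cdots M_{w_n}\mu$. Weighted automata here are over $\mathbb{R}_{\ge0}$. $\mathcal{S}^{rat}_{\mathbb{R}_{\ge0}}(\Sigma^* )$ is the set of stochastic languages over $\Sigma^*$ of the form $\llbracket\mathcal{W}\rrbracket$ for some weighted automaton $\mathcal{W}$ over $\mathbb{R}_{\ge0}$. $\mathcal{W}$ is locally sub-stochastic if the weights of the outgoing transitions of each state sum to at most $1$, i.e. every row sum of the matrix $\sum_{\sigma\in\Sigma}M_\sigma$ is at most $1$.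
   Formalization: The right-hand side additionally requires f to be stochastic: as stated, the "if" direction fails, e.g. one state with initial weight 2, final weight 1 and zero transitions is locally sub-stochastic but gives f(ε)=2. *)

theory Defs
  imports "HOL-Analysis.Infinite_Sum"
begin

definition stochastic :: "('a list \<Rightarrow> real) \<Rightarrow> bool" where
  "stochastic f \<longleftrightarrow> (\<forall>w. f w \<ge> 0) \<and> (f has_sum 1) UNIV"

record ('a, 'q) weighted_automaton =
  states :: "'q set"
  init_weight :: "'q \<Rightarrow> real"
  trans_weight :: "'a \<Rightarrow> 'q \<Rightarrow> 'q \<Rightarrow> real"
  final_weight :: "'q \<Rightarrow> real"

text \<open>The vectors and matrices are indexed by the set \<open>states W\<close>; their values outside
  this set are irrelevant.\<close>

definition wf_automaton :: "('a, 'q) weighted_automaton \<Rightarrow> bool" where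
  "wf_automaton W \<longleftrightarrow> finite (states W) \<and>
    (\<forall>q\<in>states W. init_weight W q \<ge> 0 \<and> final_weight W q \<ge> 0) \<and>
    (\<forall>\<sigma>. \<forall>p\<in>states W. \<forall>q\<in>states W. trans_weight W \<sigma> p q \<ge> 0)"

text \<open>The matrix product along a word; the empty word gives the identity matrix.\<close>

fun word_matrix :: "('a, 'q) weighted_automaton \<Rightarrow> 'a list \<Rightarrow> 'q \<Rightarrow> 'q \<Rightarrow> real" where
  "word_matrix W [] p q = (if p = q then 1 else 0)"
| "word_matrix W (\<sigma> # w) p q = (\<Sum>r\<in>states W. trans_weight W \<sigma> p r * word_matrix W w r q)"

definition semantics :: "('a, 'q) weighted_automaton \<Rightarrow> 'a list \<Rightarrow> real" where
  "semantics W w = (\<Sum>p\<in>states W. \<Sum>q\<in>states W. init_weight W p * word_matrix W w p q * final_weight W q)"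

text \<open>Only transition weights are constrained: neither the total initial weight nor the
  final weights are bounded, so a locally sub-stochastic automaton need not have a
  stochastic semantics.\<close>

definition locally_substochastic :: "('a::finite, 'q) weighted_automaton \<Rightarrow> bool" where
  "locally_substochastic W \<longleftrightarrow>
    (\<forall>p\<in>states W. (\<Sum>q\<in>states W. \<Sum>\<sigma>\<in>UNIV. trans_weight W \<sigma> p q) \<le> 1)"

text \<open>A finite state set can always be renamed to a finite set of natural numbers, which
  avoids quantifying over the type of states.\<close>

definition stochastic_rational :: "('a list \<Rightarrow> real) set" where
  "stochastic_rational = {f. stochastic f \<and>
    (\<exists>W :: ('a, nat) weighted_automaton. wf_automaton W \<and> semantics W = f)}"

end

theory Submission
  imports Defs
begin

text \<open>Let \<open>h q\<close> be the total weight of all words read from the state \<open>q\<close>. Conjugating the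
  transition matrices by the diagonal matrix of \<open>h\<close>, that is, replacing the weight from \<open>p\<close> to
  \<open>q\<close> by \<open>M p q * h q / h p\<close>, preserves the semantics. Splitting off the first letter
  gives \<open>(\<Sum>\<sigma> q. M \<sigma> p q * h q) \<le> h p\<close>, so the new automaton is locally sub-stochastic.
  No trimming is needed: \<open>h q\<close> is the junk value \<open>0\<close> if the weights diverge at \<open>q\<close>, which
  just as for vanishing weights cuts off \<open>q\<close>. A state with convergent weights has no transition
  of positive weight to a divergent one, and states of positive initial weight are convergent.\<close>

definition state_weight :: "('a, 'q) weighted_automaton \<Rightarrow> 'a list \<Rightarrow> 'q \<Rightarrow> real" where
  "state_weight W w p = (\<Sum>q\<in>states W. word_matrix W w p q * final_weight W q)"

definition total_weight :: "('a, 'q) weighted_automaton \<Rightarrow> 'q \<Rightarrow> real" where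
  "total_weight W p = (\<Sum>\<^sub>\<infinity>w. state_weight W w p)"

text \<open>Along a path the factors telescope: the quotients leave \<open>h\<close> of the last
  state over \<open>h\<close> of the first, and the final and initial weights cancel these where
  \<open>h\<close> is nonzero.\<close>

definition rescale :: "('q \<Rightarrow> real) \<Rightarrow> ('a, 'q) weighted_automaton \<Rightarrow> ('a, 'q) weighted_automaton" where
  "rescale h W = \<lparr>states = states W, init_weight = (\<lambda>q. init_weight W q * h q),
     trans_weight = (\<lambda>\<sigma> p q. trans_weight W \<sigma> p q * h q / h p),
     final_weight = (\<lambda>q. final_weight W q / h q)\<rparr>"

lemma rescale_simps [simp]:
  "states (rescale h W) = states W"
  "init_weight (rescale h W) q = init_weight W q * h q"
  "trans_weight (rescale h W) \<sigma> p q = trans_weight W \<sigma> p q * h q / h p"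
  "final_weight (rescale h W) q = final_weight W q / h q"
  by (simp_all add: rescale_def)

lemma wf_rescale:
  assumes "wf_automaton W" "\<And>q. q \<in> states W \<Longrightarrow> h q \<ge> 0"
  shows "wf_automaton (rescale h W)"
  using assms by (auto simp: wf_automaton_def)

lemma state_weight_Nil:
  assumes "finite (states W)" "p \<in> states W"
  shows "state_weight W [] p = final_weight W p"
proof -
  have "state_weight W [] p = (\<Sum>q\<in>states W. if p = q then final_weight W q else 0)"
    by (auto simp: state_weight_def intro!: sum.cong)
  with assms show ?thesis by simp
qed

lemma state_weight_Cons:
  "state_weight W (\<sigma> # w) p = (\<Sum>r\<in>states W. trans_weight W \<sigma> p r * state_weight W w r)"
  unfolding state_weight_def
  by (simp add: sum_distrib_left sum_distrib_right mult.assoc) (rule sum.swap)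

lemma semantics_eq_state_weight:
  "semantics W w = (\<Sum>p\<in>states W. init_weight W p * state_weight W w p)"
  by (simp add: semantics_def state_weight_def sum_distrib_left mult.assoc)

lemma state_weight_nonneg:
  assumes "wf_automaton W" "p \<in> states W"
  shows "state_weight W w p \<ge> 0"
  using assms(2)
proof (induction w arbitrary: p)
  case Nil
  then show ?case using assms(1) by (simp add: state_weight_Nil wf_automaton_def)
next
  case (Cons \<sigma> w)
  then show ?case using assms(1)
    by (auto simp: state_weight_Cons wf_automaton_def intro!: sum_nonneg)
qed

lemma total_weight_nonneg:
  assumes "wf_automaton W" "p \<in> states W"
  shows "total_weight W p \<ge> 0"
  unfolding total_weight_def by (intro infsum_nonneg state_weight_nonneg assms)

text \<open>Nonnegative terms with sum 0 vanish. Summability excludes that the 0 is merely the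
  default value of a divergent sum.\<close>

lemma state_weight_eq_0:
  assumes "wf_automaton W" "p \<in> states W"
    and "(\<lambda>w. state_weight W w p) summable_on UNIV" "total_weight W p = 0"
  shows "state_weight W w p = 0"
  using assms state_weight_nonneg[OF assms(1,2)]
  by (intro nonneg_infsum_le_0D[of "\<lambda>w. state_weight W w p" UNIV]) (auto simp: total_weight_def)

text \<open>Comparison: up to the positive factor \<open>init_weight W p\<close>, the series is
  dominated termwise by that of the semantics.\<close>

lemma state_weight_summable_init:
  assumes wf: "wf_automaton W" and p: "p \<in> states W"
    and sum: "semantics W summable_on UNIV" and pos: "init_weight W p \<noteq> 0"
  shows "(\<lambda>w. state_weight W w p) summable_on UNIV"
proof -
  have "init_weight W p * state_weight W w p \<le> semantics W w" for w
    unfolding semantics_eq_state_weight using wf p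
    by (intro member_le_sum[of p _ "\<lambda>p. init_weight W p * state_weight W w p"])
       (auto simp: wf_automaton_def intro!: mult_nonneg_nonneg state_weight_nonneg[OF wf])
  moreover have "init_weight W p * state_weight W w p \<ge> 0" for w
    using wf p by (auto simp: wf_automaton_def intro!: mult_nonneg_nonneg state_weight_nonneg[OF wf])
  ultimately have "(\<lambda>w. init_weight W p * state_weight W w p) summable_on UNIV"
    by (intro summable_on_comparison_test[OF sum]) auto
  then show ?thesis using pos by (simp add: summable_on_cmult_right')
qed

lemma state_weight_Cons_summable:
  assumes "(\<lambda>w. state_weight W w p) summable_on UNIV"
  shows "(\<lambda>w. state_weight W (\<sigma> # w) p) summable_on UNIV"
proof -
  have "(\<lambda>w. state_weight W w p) summable_on range ((#) \<sigma>)"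
    using assms by (rule summable_on_subset_banach) auto
  then show ?thesis by (subst (asm) summable_on_reindex) (auto simp: o_def)
qed

text \<open>The same comparison, now with the words read from \<open>p\<close> that start with
  \<open>\<sigma>\<close>. It keeps an induction along transitions of nonzero weight among
  convergent states.\<close>

lemma state_weight_summable_step:
  assumes wf: "wf_automaton W" and p: "p \<in> states W" and q: "q \<in> states W"
    and sum: "(\<lambda>w. state_weight W w p) summable_on UNIV" and pos: "trans_weight W \<sigma> p q \<noteq> 0"
  shows "(\<lambda>w. state_weight W w q) summable_on UNIV"
proof -
  have "trans_weight W \<sigma> p q * state_weight W w q \<le> state_weight W (\<sigma> # w) p" for w
    unfolding state_weight_Cons using wf p q
    by (intro member_le_sum[of q _ "\<lambda>q. trans_weight W \<sigma> p q * state_weight W w q"])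
       (auto simp: wf_automaton_def intro!: mult_nonneg_nonneg state_weight_nonneg[OF wf])
  moreover have "trans_weight W \<sigma> p q * state_weight W w q \<ge> 0" for w
    using wf p q by (auto simp: wf_automaton_def intro!: mult_nonneg_nonneg state_weight_nonneg[OF wf])
  ultimately have "(\<lambda>w. trans_weight W \<sigma> p q * state_weight W w q) summable_on UNIV"
    by (intro summable_on_comparison_test[OF state_weight_Cons_summable[OF sum]]) auto
  then show ?thesis using pos by (simp add: summable_on_cmult_right')
qed

lemma has_sum_sum:
  fixes f :: "'b \<Rightarrow> 'c \<Rightarrow> 'd::topological_comm_monoid_add"
  assumes "finite B" "\<And>b. b \<in> B \<Longrightarrow> (f b has_sum s b) A"
  shows "((\<lambda>x. \<Sum>b\<in>B. f b x) has_sum (\<Sum>b\<in>B. s b)) A"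
  using assms by (induction B rule: finite_induct) (auto intro!: has_sum_add)

lemma infsum_state_weight_Cons:
  assumes wf: "wf_automaton W" and p: "p \<in> states W"
    and sum: "(\<lambda>w. state_weight W w p) summable_on UNIV"
  shows "(\<Sum>\<^sub>\<infinity>w. state_weight W (\<sigma> # w) p) =
    (\<Sum>q\<in>states W. trans_weight W \<sigma> p q * total_weight W q)"
proof -
  have "((\<lambda>w. trans_weight W \<sigma> p q * state_weight W w q) has_sum
      trans_weight W \<sigma> p q * total_weight W q) UNIV" if "q \<in> states W" for q
    using state_weight_summable_step[OF wf p that sum, of \<sigma>] unfolding total_weight_def
    \<comment> \<open>The series at \<open>q\<close> can diverge only if the transition weight is 0,
      and then every term and the claimed sum are 0.\<close>
    by (cases "trans_weight W \<sigma> p q = 0") (auto intro: has_sum_cmult_right has_sum_infsum)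
  moreover have "finite (states W)"
    using wf by (simp add: wf_automaton_def)
  ultimately show ?thesis
    unfolding state_weight_Cons by (intro infsumI has_sum_sum)
qed

text \<open>Cutting off the first letter identifies the left side with the sum over the nonempty
  words; the gap to \<open>total_weight W p\<close> is the nonnegative weight of the empty
  word.\<close>

lemma total_weight_superharmonic:
  fixes W :: "('a::finite, 'q) weighted_automaton"
  assumes wf: "wf_automaton W" and p: "p \<in> states W"
    and sum: "(\<lambda>w. state_weight W w p) summable_on UNIV"
  shows "(\<Sum>q\<in>states W. \<Sum>\<sigma>\<in>UNIV. trans_weight W \<sigma> p q * total_weight W q) \<le> total_weight W p"
proof -
  let ?C = "\<lambda>(\<sigma>, w). \<sigma> # w"
  have inj: "inj ?C" by (auto simp: inj_on_def)
  have sC: "(\<lambda>w. state_weight W w p) summable_on range ?C"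
    using sum by (rule summable_on_subset_banach) auto
  have eq: "(\<lambda>w. state_weight W w p) \<circ> ?C = (\<lambda>(\<sigma>, w). state_weight W (\<sigma> # w) p)"
    by auto
  have s2: "(\<lambda>(\<sigma>, w). state_weight W (\<sigma> # w) p) summable_on UNIV \<times> UNIV"
    using sC by (simp only: summable_on_reindex[OF inj] eq UNIV_Times_UNIV)
  have "(\<Sum>q\<in>states W. \<Sum>\<sigma>\<in>UNIV. trans_weight W \<sigma> p q * total_weight W q) =
      (\<Sum>\<sigma>\<in>UNIV. \<Sum>\<^sub>\<infinity>w. state_weight W (\<sigma> # w) p)"
    by (subst sum.swap) (simp add: infsum_state_weight_Cons[OF wf p sum])
  \<comment> \<open>Fubini; the outer sum ranges over the finite alphabet, so it is an ordinary
    sum.\<close>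
  also have "\<dots> = (\<Sum>\<^sub>\<infinity>(\<sigma>, w)\<in>UNIV \<times> UNIV. state_weight W (\<sigma> # w) p)"
    using infsum_Sigma'_banach[OF s2] by simp
  also have "\<dots> = (\<Sum>\<^sub>\<infinity>w\<in>range ?C. state_weight W w p)"
    by (simp only: infsum_reindex[OF inj] eq UNIV_Times_UNIV)
  also have "\<dots> \<le> total_weight W p"
    unfolding total_weight_def
    by (rule infsum_mono_neutral[OF sC sum]) (auto intro: state_weight_nonneg[OF wf p])
  finally show ?thesis .
qed

text \<open>The product form fits the factor \<open>total_weight W q\<close> carried both by
  rescaled transitions into \<open>q\<close> and by the rescaled initial weight of
  \<open>q\<close>.\<close>

lemma state_weight_rescale:
  assumes wf: "wf_automaton W" and "p \<in> states W" "(\<lambda>w. state_weight W w p) summable_on UNIV"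
  shows "total_weight W p * state_weight (rescale (total_weight W) W) w p = state_weight W w p"
  using assms(2,3)
proof (induction w arbitrary: p)
  case Nil
  have "finite (states W)" using wf by (simp add: wf_automaton_def)
  \<comment> \<open>If the total weight is 0, so is the final weight, being the weight of
    \<open>[]\<close>.\<close>
  then show ?case using Nil state_weight_eq_0[OF wf Nil, of "[]"] by (auto simp: state_weight_Nil)
next
  case (Cons \<sigma> w)
  let ?V = "rescale (total_weight W) W"
  show ?case
  proof (cases "total_weight W p = 0")
    case True
    then show ?thesis using state_weight_eq_0[OF wf Cons.prems] by simp
  next
    case False
    have "total_weight W p * state_weight ?V (\<sigma> # w) p =
        (\<Sum>q\<in>states W. trans_weight W \<sigma> p q * (total_weight W q * state_weight ?V w q))"
      using False by (simp add: state_weight_Cons sum_distrib_left mult_ac)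
    \<comment> \<open>The induction hypothesis covers the convergent \<open>q\<close>; for all
      others the transition weight is 0.\<close>
    also have "\<dots> = (\<Sum>q\<in>states W. trans_weight W \<sigma> p q * state_weight W w q)"
      using Cons.IH state_weight_summable_step[OF wf Cons.prems(1) _ Cons.prems(2)]
      by (intro sum.cong) auto
    finally show ?thesis by (simp add: state_weight_Cons)
  qed
qed

lemma semantics_rescale_total_weight:
  assumes wf: "wf_automaton W" and sum: "semantics W summable_on UNIV"
  shows "semantics (rescale (total_weight W) W) = semantics W"
proof
  fix w
  \<comment> \<open>A state of nonzero initial weight is convergent, so the previous identity
    applies; elsewhere both sides are 0.\<close>
  have "init_weight W p * total_weight W p * state_weight (rescale (total_weight W) W) w p =
      init_weight W p * state_weight W w p" if "p \<in> states W" for p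
    using state_weight_rescale[OF wf that] state_weight_summable_init[OF wf that sum]
    by (cases "init_weight W p = 0") (auto simp: mult.assoc)
  then show "semantics (rescale (total_weight W) W) w = semantics W w"
    unfolding semantics_eq_state_weight rescale_simps by (intro sum.cong refl)
qed

text \<open>The superharmonic inequality at \<open>p\<close>, divided by
  \<open>total_weight W p\<close>.\<close>

lemma locally_substochastic_rescale_total_weight:
  assumes wf: "wf_automaton W"
  shows "locally_substochastic (rescale (total_weight W) W)"
  unfolding locally_substochastic_def rescale_simps
proof
  fix p assume p: "p \<in> states W"
  let ?s = "\<Sum>q\<in>states W. \<Sum>\<sigma>\<in>UNIV. trans_weight W \<sigma> p q * total_weight W q / total_weight W p"
  show "?s \<le> 1"
  proof (cases "total_weight W p = 0")
    case False
    \<comment> \<open>A divergent sum would have the default value 0.\<close>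
    then have "(\<lambda>w. state_weight W w p) summable_on UNIV"
      unfolding total_weight_def using infsum_not_exists by blast
    from total_weight_superharmonic[OF wf p this] False total_weight_nonneg[OF wf p]
    show ?thesis by (simp add: sum_divide_distrib[symmetric])
  \<comment> \<open>Division by 0 makes the whole row 0.\<close>
  qed simp
qed

theorem theorem5:
  fixes f :: "'a::finite list \<Rightarrow> real"
  shows "f \<in> stochastic_rational \<longleftrightarrow>
    stochastic f \<and>
    (\<exists>W :: ('a, nat) weighted_automaton.
        wf_automaton W \<and> locally_substochastic W \<and> semantics W = f)"
proof
  assume "f \<in> stochastic_rational"
  then obtain W :: "('a, nat) weighted_automaton"
    where f: "stochastic f" and wf: "wf_automaton W" and W: "semantics W = f"
    by (auto simp: stochastic_rational_def)
  have "semantics W summable_on UNIV"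
    using f W by (auto simp: stochastic_def summable_on_def)
  then have "semantics (rescale (total_weight W) W) = f"
    using semantics_rescale_total_weight[OF wf] W by simp
  moreover have "wf_automaton (rescale (total_weight W) W)"
    using wf by (intro wf_rescale total_weight_nonneg)
  ultimately show "stochastic f \<and> (\<exists>W :: ('a, nat) weighted_automaton.
      wf_automaton W \<and> locally_substochastic W \<and> semantics W = f)"
    using f locally_substochastic_rescale_total_weight[OF wf] by (intro conjI exI)
\<comment> \<open>Conversely, the locally sub-stochastic automaton is itself the witness.\<close>
qed (auto simp: stochastic_rational_def)

end
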